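(* Let $R$ be a ring with an automorphism $\sigma$, $\sigma\neq\mathrm{id}_R$, $\sigma\neq 0$. Let $\Delta$ be the multiplicatively closed subset of $R$ consisting of all central regular elements of $R$, and let $\bar\sigma$ be the automorphism of $\Delta^{-1}R$ given by $\bar\sigma(u^{-1}r)=\sigma(u)^{-1}\sigma(r)$ for $r\in R$, $u\in\Delta$. Then $R$ is strongly $\sigma$-symmetric if and only if $\Delta^{-1}R$ is strongly $\bar\sigma$-symmetric.
   Context: Rings are associative with identity, not necessarily commutative. For a ring $T$ and a ring endomorphism $\tau$ of $T$ with $\tau(1)=1$, the skew polynomial ring $T[x;\tau]$ consists of polynomials $\sum a_i x^i$ with $a_i\in T$, usual addition, and multiplication determined by $xr=\tau(r)x$ for $r\in T$. A ring is symmetric if $abc=0$ implies $acb=0$ for all elements $a,b,c$. $T$ is strongly $\tau$-symmetric if $T[x;\tau]$ is symmetric. An element $u\in R$ is regular if $ur=0$ implies $r=0$ and $ru=0$ implies $r=0$, for $r\in R$. $\Delta^{-1}R$ denotes the localization of $R$ at the central regular elements in $\Delta$. *)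

theory Defs
  imports "HOL-Algebra.QuotRing" "HOL-Algebra.UnivPoly"
begin

section \<open>Symmetric rings and skew polynomial rings\<close>

definition symmetric_ring :: "('a, 'm) ring_scheme \<Rightarrow> bool" where
  "symmetric_ring R \<longleftrightarrow>
     (\<forall>a\<in>carrier R. \<forall>b\<in>carrier R. \<forall>c\<in>carrier R.
        a \<otimes>\<^bsub>R\<^esub> b \<otimes>\<^bsub>R\<^esub> c = \<zero>\<^bsub>R\<^esub> \<longrightarrow> a \<otimes>\<^bsub>R\<^esub> c \<otimes>\<^bsub>R\<^esub> b = \<zero>\<^bsub>R\<^esub>)"

text \<open>
  A skew polynomial is its coefficient sequence \<open>p\<close>, with coefficients on the left:
  \<open>p = \<Sum>i. p i x\<^sup>i\<close>.  From \<open>x r = \<tau>(r) x\<close> one gets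
  \<open>(a x\<^sup>i) (b x\<^sup>j) = a \<tau>\<^sup>i(b) x\<^sup>i\<^sup>+\<^sup>j\<close>.  The carrier is the library's
  set \<^const>\<open>up\<close> of finitely supported sequences.
\<close>
definition skew_poly_ring :: "('a, 'm) ring_scheme \<Rightarrow> ('a \<Rightarrow> 'a) \<Rightarrow> (nat \<Rightarrow> 'a) ring" where
  "skew_poly_ring T \<tau> =
     \<lparr>carrier = up T,
      mult = (\<lambda>p q n. \<Oplus>\<^bsub>T\<^esub>i\<in>{..n}. p i \<otimes>\<^bsub>T\<^esub> (\<tau> ^^ i) (q (n - i))),
      one = (\<lambda>n. if n = 0 then \<one>\<^bsub>T\<^esub> else \<zero>\<^bsub>T\<^esub>),
      zero = (\<lambda>n. \<zero>\<^bsub>T\<^esub>),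
      add = (\<lambda>p q n. p n \<oplus>\<^bsub>T\<^esub> q n)\<rparr>"

definition strongly_symmetric :: "('a, 'm) ring_scheme \<Rightarrow> ('a \<Rightarrow> 'a) \<Rightarrow> bool" where
  "strongly_symmetric T \<tau> \<longleftrightarrow> symmetric_ring (skew_poly_ring T \<tau>)"


section \<open>Localization at central regular elements\<close>

definition regular_element :: "('a, 'm) ring_scheme \<Rightarrow> 'a \<Rightarrow> bool" where
  "regular_element R u \<longleftrightarrow>
     (\<forall>r\<in>carrier R. u \<otimes>\<^bsub>R\<^esub> r = \<zero>\<^bsub>R\<^esub> \<longrightarrow> r = \<zero>\<^bsub>R\<^esub>) \<and>
     (\<forall>r\<in>carrier R. r \<otimes>\<^bsub>R\<^esub> u = \<zero>\<^bsub>R\<^esub> \<longrightarrow> r = \<zero>\<^bsub>R\<^esub>)"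

definition central_regular :: "('a, 'm) ring_scheme \<Rightarrow> 'a set" where
  "central_regular R =
     {u \<in> carrier R. (\<forall>r\<in>carrier R. u \<otimes>\<^bsub>R\<^esub> r = r \<otimes>\<^bsub>R\<^esub> u) \<and> regular_element R u}"

text \<open>
  The pair \<open>(u, r)\<close> represents the fraction \<open>u\<^sup>-\<^sup>1 r\<close>.  Below, \<open>D\<close> is meant to be a
  multiplicatively closed set of central regular elements; then \<open>u\<^sup>-\<^sup>1 r = v\<^sup>-\<^sup>1 s\<close> iff
  \<open>v r = u s\<close>, with no further element of \<open>D\<close> needed as a factor.
\<close>
definition frac_rel :: "('a, 'm) ring_scheme \<Rightarrow> 'a set \<Rightarrow> (('a \<times> 'a) \<times> ('a \<times> 'a)) set" where
  "frac_rel R D =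
     {((u, r), (v, s)). u \<in> D \<and> r \<in> carrier R \<and> v \<in> D \<and> s \<in> carrier R \<and>
        v \<otimes>\<^bsub>R\<^esub> r = u \<otimes>\<^bsub>R\<^esub> s}"

definition frac :: "('a, 'm) ring_scheme \<Rightarrow> 'a set \<Rightarrow> 'a \<Rightarrow> 'a \<Rightarrow> ('a \<times> 'a) set" where
  "frac R D u r = frac_rel R D `` {(u, r)}"

text \<open>
  Operations on classes are the unions over all representatives, which are independent of
  the representatives when \<open>D\<close> is as above; see \<open>frac_add\<close>, \<open>frac_mult\<close> and \<open>localization_map_frac\<close> below for
  their values on fractions.
\<close>
definition localization :: "('a, 'm) ring_scheme \<Rightarrow> 'a set \<Rightarrow> ('a \<times> 'a) set ring" where
  "localization R D =
     \<lparr>carrier = (D \<times> carrier R) // frac_rel R D,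
      mult = (\<lambda>X Y. \<Union>(u, r)\<in>X. \<Union>(v, s)\<in>Y. frac R D (u \<otimes>\<^bsub>R\<^esub> v) (r \<otimes>\<^bsub>R\<^esub> s)),
      one = frac R D \<one>\<^bsub>R\<^esub> \<one>\<^bsub>R\<^esub>,
      zero = frac R D \<one>\<^bsub>R\<^esub> \<zero>\<^bsub>R\<^esub>,
      add = (\<lambda>X Y. \<Union>(u, r)\<in>X. \<Union>(v, s)\<in>Y.
               frac R D (u \<otimes>\<^bsub>R\<^esub> v) (v \<otimes>\<^bsub>R\<^esub> r \<oplus>\<^bsub>R\<^esub> u \<otimes>\<^bsub>R\<^esub> s))\<rparr>"

definition localization_map ::
    "('a, 'm) ring_scheme \<Rightarrow> 'a set \<Rightarrow> ('a \<Rightarrow> 'a) \<Rightarrow> ('a \<times> 'a) set \<Rightarrow> ('a \<times> 'a) set" where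
  "localization_map R D \<sigma> X = (\<Union>(u, r)\<in>X. frac R D (\<sigma> u) (\<sigma> r))"


section \<open>The constructions are well defined\<close>

context ring
begin

abbreviation (input) cr where "cr \<equiv> central_regular R"
abbreviation (input) L where "L \<equiv> localization R (central_regular R)"

lemma cr_carrier: "u \<in> cr \<Longrightarrow> u \<in> carrier R"
  by (simp add: central_regular_def)

lemma cr_comm: "u \<in> cr \<Longrightarrow> r \<in> carrier R \<Longrightarrow> u \<otimes> r = r \<otimes> u"
  by (simp add: central_regular_def)

lemma cr_lcomm:
  assumes "u \<in> cr" "r \<in> carrier R" "s \<in> carrier R"
  shows "r \<otimes> (u \<otimes> s) = u \<otimes> (r \<otimes> s)"
proof -
  have u: "u \<in> carrier R" using assms(1) by (rule cr_carrier)
  have "r \<otimes> (u \<otimes> s) = (r \<otimes> u) \<otimes> s" using u assms(2,3) by (simp only: m_assoc)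
  also have "r \<otimes> u = u \<otimes> r" using cr_comm[OF assms(1,2)] by (rule sym)
  also have "(u \<otimes> r) \<otimes> s = u \<otimes> (r \<otimes> s)" using u assms(2,3) by (simp only: m_assoc)
  finally show ?thesis .
qed

lemma cr_zeroD: "u \<in> cr \<Longrightarrow> r \<in> carrier R \<Longrightarrow> u \<otimes> r = \<zero> \<Longrightarrow> r = \<zero>"
  unfolding central_regular_def regular_element_def by blast

lemma cr_cancel:
  assumes "u \<in> cr" "r \<in> carrier R" "s \<in> carrier R" "u \<otimes> r = u \<otimes> s"
  shows "r = s"
proof -
  have u: "u \<in> carrier R" using assms(1) by (rule cr_carrier)
  have "u \<otimes> (r \<ominus> s) = u \<otimes> r \<oplus> \<ominus> (u \<otimes> s)"
    using assms(2,3) u by (simp add: a_minus_def r_distr r_minus)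
  also have "\<dots> = \<zero>" using assms(3) u by (simp only: assms(4) r_neg m_closed)
  finally have "u \<otimes> (r \<ominus> s) = \<zero>" .
  then have "r \<ominus> s = \<zero>" by (rule cr_zeroD[OF assms(1) minus_closed[OF assms(2,3)]])
  then have "r \<oplus> \<ominus> s = \<zero>" by (simp only: a_minus_def)
  then have "\<ominus> (\<ominus> s) = r" using assms(2,3) by (intro minus_equality a_inv_closed)
  then show ?thesis using assms(3) by (simp only: minus_minus)
qed

lemma cr_one: "\<one> \<in> cr"
  unfolding central_regular_def regular_element_def mem_Collect_eq
  by (intro conjI ballI impI) (simp_all only: one_closed l_one r_one)

lemma cr_mult: assumes "u \<in> cr" "v \<in> cr" shows "u \<otimes> v \<in> cr"
proof -
  have c: "u \<in> carrier R" "v \<in> carrier R" using assms cr_carrier by auto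
  have comm: "(u \<otimes> v) \<otimes> r = r \<otimes> (u \<otimes> v)" if r: "r \<in> carrier R" for r
  proof -
    have "(u \<otimes> v) \<otimes> r = u \<otimes> (r \<otimes> v)" using cr_comm[OF assms(2) r] c r by (simp add: m_assoc)
    also have "\<dots> = r \<otimes> (u \<otimes> v)" using cr_lcomm[OF assms(1) r c(2)] by simp
    finally show ?thesis .
  qed
  have reg: "r = \<zero>" if r: "r \<in> carrier R" and z: "(u \<otimes> v) \<otimes> r = \<zero>" for r
  proof -
    have "u \<otimes> (v \<otimes> r) = \<zero>" using z c r by (simp add: m_assoc)
    then have "v \<otimes> r = \<zero>" using cr_zeroD[OF assms(1)] c r by blast
    then show ?thesis using cr_zeroD[OF assms(2) r] by blast
  qed
  have reg': "r = \<zero>" if r: "r \<in> carrier R" and z: "r \<otimes> (u \<otimes> v) = \<zero>" for r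
    using r by (rule reg) (simp only: comm[OF r] z)
  show ?thesis
    unfolding central_regular_def regular_element_def mem_Collect_eq
    by (intro conjI ballI impI)
      (rule m_closed[OF c] | erule comm | erule (1) reg | erule (1) reg')+
qed

lemma equiv_frac_rel: "equiv (cr \<times> carrier R) (frac_rel R cr)"
proof (rule equivI)
  show "frac_rel R cr \<subseteq> (cr \<times> carrier R) \<times> (cr \<times> carrier R)"
    by (auto simp: frac_rel_def)
  show "refl_on (cr \<times> carrier R) (frac_rel R cr)"
    by (auto simp: refl_on_def frac_rel_def)
  show "sym (frac_rel R cr)"
    by (auto simp: sym_def frac_rel_def)
  show "trans (frac_rel R cr)"
  proof (rule transI, clarsimp simp: frac_rel_def)
    fix u r v s w t
    assume h: "u \<in> cr" "r \<in> carrier R" "v \<in> cr" "s \<in> carrier R" "w \<in> cr" "t \<in> carrier R"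
      and eq: "v \<otimes> r = u \<otimes> s" "w \<otimes> s = v \<otimes> t"
    have c: "u \<in> carrier R" "v \<in> carrier R" "w \<in> carrier R" using h cr_carrier by auto
    have "v \<otimes> (w \<otimes> r) = w \<otimes> (v \<otimes> r)" using h c by (simp add: cr_lcomm)
    also have "\<dots> = w \<otimes> (u \<otimes> s)" by (simp only: eq)
    also have "\<dots> = u \<otimes> (w \<otimes> s)" using h c by (simp add: cr_lcomm)
    also have "\<dots> = u \<otimes> (v \<otimes> t)" by (simp only: eq)
    also have "\<dots> = v \<otimes> (u \<otimes> t)" using h c by (simp add: cr_lcomm)
    finally have "v \<otimes> (w \<otimes> r) = v \<otimes> (u \<otimes> t)" .
    from cr_cancel[OF h(3) _ _ this] show "w \<otimes> r = u \<otimes> t"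
      using h(2,6) c(1,3) by (simp only: m_closed)
  qed
qed

lemma frac_eq_iff:
  assumes "u \<in> cr" "r \<in> carrier R" "v \<in> cr" "s \<in> carrier R"
  shows "frac R cr u r = frac R cr v s \<longleftrightarrow> v \<otimes> r = u \<otimes> s"
  unfolding frac_def
  using eq_equiv_class_iff[OF equiv_frac_rel, of "(u, r)" "(v, s)"] assms
  by (auto simp: frac_rel_def)

lemma frac_memD:
  assumes "(v, s) \<in> frac R cr u r"
  shows "u \<in> cr" "r \<in> carrier R" "v \<in> cr" "s \<in> carrier R" "v \<otimes> r = u \<otimes> s"
  using assms by (auto simp: frac_def frac_rel_def)

lemma frac_self: "u \<in> cr \<Longrightarrow> r \<in> carrier R \<Longrightarrow> (u, r) \<in> frac R cr u r"
  by (auto simp: frac_def frac_rel_def)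

lemma frac_closed: "u \<in> cr \<Longrightarrow> r \<in> carrier R \<Longrightarrow> frac R cr u r \<in> carrier L"
  by (auto simp: localization_def frac_def quotient_def)

lemma localizationE:
  assumes "X \<in> carrier L"
  obtains u r where "u \<in> cr" "r \<in> carrier R" "X = frac R cr u r"
  using assms by (auto simp: localization_def frac_def quotient_def)

lemma UN_pair_const:
  "(a, b) \<in> X \<Longrightarrow> (\<And>u r. (u, r) \<in> X \<Longrightarrow> f u r = c) \<Longrightarrow> (\<Union>(u, r)\<in>X. f u r) = c"
  by (auto 0 3)

lemma frac_mult:
  assumes "u \<in> cr" "r \<in> carrier R" "v \<in> cr" "s \<in> carrier R"
  shows "frac R cr u r \<otimes>\<^bsub>L\<^esub> frac R cr v s = frac R cr (u \<otimes> v) (r \<otimes> s)"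
proof -
  have "frac R cr (u' \<otimes> v') (r' \<otimes> s') = frac R cr (u \<otimes> v) (r \<otimes> s)"
    if "(u', r') \<in> frac R cr u r" "(v', s') \<in> frac R cr v s" for u' r' v' s'
  proof -
    note a = frac_memD[OF that(1)] and b = frac_memD[OF that(2)]
    note c = a(1,3)[THEN cr_carrier] b(1,3)[THEN cr_carrier]
    have "(u \<otimes> v) \<otimes> (r' \<otimes> s') = (u \<otimes> r') \<otimes> (v \<otimes> s')"
      using a(1-4) b(1-4) c by (simp add: m_assoc cr_lcomm)
    also have "\<dots> = (u' \<otimes> r) \<otimes> (v' \<otimes> s)"
      by (simp only: a(5) b(5))
    also have "\<dots> = (u' \<otimes> v') \<otimes> (r \<otimes> s)"
      using a(1-4) b(1-4) c by (simp add: m_assoc cr_lcomm)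
    finally show ?thesis
      using a(1-4) b(1-4) by (intro frac_eq_iff[THEN iffD2]) (simp_all add: cr_mult)
  qed
  note key = this
  show ?thesis
    unfolding localization_def ring.simps monoid.simps
    by (rule UN_pair_const[OF frac_self[OF assms(1,2)]],
        rule UN_pair_const[OF frac_self[OF assms(3,4)]], rule key)
qed

lemma frac_add:
  assumes "u \<in> cr" "r \<in> carrier R" "v \<in> cr" "s \<in> carrier R"
  shows "frac R cr u r \<oplus>\<^bsub>L\<^esub> frac R cr v s = frac R cr (u \<otimes> v) (v \<otimes> r \<oplus> u \<otimes> s)"
proof -
  have "frac R cr (u' \<otimes> v') (v' \<otimes> r' \<oplus> u' \<otimes> s') = frac R cr (u \<otimes> v) (v \<otimes> r \<oplus> u \<otimes> s)"
    if "(u', r') \<in> frac R cr u r" "(v', s') \<in> frac R cr v s" for u' r' v' s'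
  proof -
    note a = frac_memD[OF that(1)] and b = frac_memD[OF that(2)]
    note c = a(1,3)[THEN cr_carrier] b(1,3)[THEN cr_carrier]
    have "(u \<otimes> v) \<otimes> (v' \<otimes> r' \<oplus> u' \<otimes> s')
        = (u \<otimes> v) \<otimes> (v' \<otimes> r') \<oplus> (u \<otimes> v) \<otimes> (u' \<otimes> s')"
      using a(1-4) b(1-4) c by (simp add: r_distr)
    also have "(u \<otimes> v) \<otimes> (v' \<otimes> r') = v \<otimes> v' \<otimes> (u \<otimes> r')"
      using a(1-4) b(1-4) c by (simp add: m_assoc cr_lcomm)
    also have "\<dots> = v \<otimes> v' \<otimes> (u' \<otimes> r)" by (simp only: a(5))
    also have "\<dots> = (u' \<otimes> v') \<otimes> (v \<otimes> r)"
      using a(1-4) b(1-4) c by (simp add: m_assoc cr_lcomm)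
    also have "(u \<otimes> v) \<otimes> (u' \<otimes> s') = u \<otimes> u' \<otimes> (v \<otimes> s')"
      using a(1-4) b(1-4) c by (simp add: m_assoc cr_lcomm)
    also have "\<dots> = u \<otimes> u' \<otimes> (v' \<otimes> s)" by (simp only: b(5))
    also have "\<dots> = (u' \<otimes> v') \<otimes> (u \<otimes> s)"
      using a(1-4) b(1-4) c by (simp add: m_assoc cr_lcomm)
    finally have "(u \<otimes> v) \<otimes> (v' \<otimes> r' \<oplus> u' \<otimes> s') = (u' \<otimes> v') \<otimes> (v \<otimes> r \<oplus> u \<otimes> s)"
      using a(1-4) b(1-4) c by (simp add: r_distr)
    then show ?thesis
      using a(1-4) b(1-4) c by (intro frac_eq_iff[THEN iffD2]) (simp_all add: cr_mult)
  qed
  note key = this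
  show ?thesis
    unfolding localization_def ring.simps monoid.simps
    by (rule UN_pair_const[OF frac_self[OF assms(1,2)]],
        rule UN_pair_const[OF frac_self[OF assms(3,4)]], rule key)
qed

lemma localization_zero: "\<zero>\<^bsub>L\<^esub> = frac R cr \<one> \<zero>"
  by (simp add: localization_def)

lemma localization_one: "\<one>\<^bsub>L\<^esub> = frac R cr \<one> \<one>"
  by (simp add: localization_def)

theorem ring_localization: "ring L"
proof (rule ringI)
  note simps = frac_add frac_mult cr_mult cr_carrier cr_one localization_zero localization_one
  show "abelian_group L"
  proof (rule abelian_groupI)
    fix X Y assume "X \<in> carrier L" "Y \<in> carrier L"
    then obtain u r v s where h: "u \<in> cr" "r \<in> carrier R" "X = frac R cr u r"
       "v \<in> cr" "s \<in> carrier R" "Y = frac R cr v s" by (metis localizationE)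
    then show "X \<oplus>\<^bsub>L\<^esub> Y \<in> carrier L" by (simp add: simps frac_closed)
    show "X \<oplus>\<^bsub>L\<^esub> Y = Y \<oplus>\<^bsub>L\<^esub> X" using h by (simp add: simps a_comm cr_comm)
  next
    show "\<zero>\<^bsub>L\<^esub> \<in> carrier L" by (simp add: simps frac_closed)
  next
    fix X Y Z assume "X \<in> carrier L" "Y \<in> carrier L" "Z \<in> carrier L"
    then obtain u r v s w t where h: "u \<in> cr" "r \<in> carrier R" "X = frac R cr u r"
       "v \<in> cr" "s \<in> carrier R" "Y = frac R cr v s" "w \<in> cr" "t \<in> carrier R" "Z = frac R cr w t"
      by (metis localizationE)
    then show "(X \<oplus>\<^bsub>L\<^esub> Y) \<oplus>\<^bsub>L\<^esub> Z = X \<oplus>\<^bsub>L\<^esub> (Y \<oplus>\<^bsub>L\<^esub> Z)"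
      by (simp add: simps r_distr a_assoc m_assoc cr_lcomm)
  next
    fix X assume "X \<in> carrier L"
    then obtain u r where h: "u \<in> cr" "r \<in> carrier R" "X = frac R cr u r"
      by (metis localizationE)
    show "\<zero>\<^bsub>L\<^esub> \<oplus>\<^bsub>L\<^esub> X = X" using h by (simp add: simps)
    have "frac R cr u (\<ominus> r) \<oplus>\<^bsub>L\<^esub> X = \<zero>\<^bsub>L\<^esub>"
      using h by (simp add: simps r_minus l_neg frac_eq_iff)
    then show "\<exists>Y\<in>carrier L. Y \<oplus>\<^bsub>L\<^esub> X = \<zero>\<^bsub>L\<^esub>"
      using h frac_closed by blast
  qed
  show "monoid L"
  proof (rule monoidI)
    show "\<one>\<^bsub>L\<^esub> \<in> carrier L" by (simp add: simps frac_closed)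
  next
    fix X Y assume "X \<in> carrier L" "Y \<in> carrier L"
    then show "X \<otimes>\<^bsub>L\<^esub> Y \<in> carrier L"
      by (auto elim!: localizationE simp: simps frac_closed)
  next
    fix X Y Z assume "X \<in> carrier L" "Y \<in> carrier L" "Z \<in> carrier L"
    then show "(X \<otimes>\<^bsub>L\<^esub> Y) \<otimes>\<^bsub>L\<^esub> Z = X \<otimes>\<^bsub>L\<^esub> (Y \<otimes>\<^bsub>L\<^esub> Z)"
      by (auto elim!: localizationE simp: simps m_assoc)
  next
    fix X assume "X \<in> carrier L"
    then show "\<one>\<^bsub>L\<^esub> \<otimes>\<^bsub>L\<^esub> X = X" "X \<otimes>\<^bsub>L\<^esub> \<one>\<^bsub>L\<^esub> = X"
      by (auto elim!: localizationE simp: simps)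
  qed
next
  fix X Y Z assume "X \<in> carrier L" "Y \<in> carrier L" "Z \<in> carrier L"
  then obtain u r v s w t where h: "u \<in> cr" "r \<in> carrier R" "X = frac R cr u r"
     "v \<in> cr" "s \<in> carrier R" "Y = frac R cr v s" "w \<in> cr" "t \<in> carrier R" "Z = frac R cr w t"
    by (metis localizationE)
  then show "(X \<oplus>\<^bsub>L\<^esub> Y) \<otimes>\<^bsub>L\<^esub> Z = X \<otimes>\<^bsub>L\<^esub> Z \<oplus>\<^bsub>L\<^esub> Y \<otimes>\<^bsub>L\<^esub> Z"
    by (simp add: frac_add frac_mult cr_mult cr_carrier frac_eq_iff)
       (simp add: cr_carrier cr_mult l_distr r_distr m_assoc cr_lcomm)
  show "Z \<otimes>\<^bsub>L\<^esub> (X \<oplus>\<^bsub>L\<^esub> Y) = Z \<otimes>\<^bsub>L\<^esub> X \<oplus>\<^bsub>L\<^esub> Z \<otimes>\<^bsub>L\<^esub> Y"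
  proof -
    have e: "t \<otimes> (v \<otimes> r) = v \<otimes> (t \<otimes> r)" "t \<otimes> (u \<otimes> s) = u \<otimes> (t \<otimes> s)"
      using cr_lcomm[OF h(4) h(8) h(2)] cr_lcomm[OF h(1) h(8) h(5)] .
    show ?thesis
      using h by (simp add: frac_add frac_mult cr_mult cr_carrier frac_eq_iff)
        (simp add: cr_carrier cr_mult l_distr r_distr m_assoc cr_lcomm e)
  qed
qed

lemma ring_iso_cr:
  assumes "\<sigma> \<in> ring_iso R R" "u \<in> carrier R"
  shows "\<sigma> u \<in> cr \<longleftrightarrow> u \<in> cr"
proof -
  have b: "bij_betw \<sigma> (carrier R) (carrier R)" and m: "\<And>x. x \<in> carrier R \<Longrightarrow> \<sigma> x \<in> carrier R"
    and mul: "\<And>x y. x \<in> carrier R \<Longrightarrow> y \<in> carrier R \<Longrightarrow> \<sigma> (x \<otimes> y) = \<sigma> x \<otimes> \<sigma> y"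
    using assms(1) by (auto simp: ring_iso_def ring_hom_def)
  have z: "\<sigma> \<zero> = \<zero>"
    using assms(1) ring_hom_zero[of \<sigma> R R] ring_axioms by (auto simp: ring_iso_def)
  have eq: "\<sigma> x = \<sigma> y \<longleftrightarrow> x = y" if "x \<in> carrier R" "y \<in> carrier R" for x y
    using b that by (meson bij_betw_def inj_on_eq_iff)
  have img: "carrier R = \<sigma> ` carrier R" using b by (simp add: bij_betw_def)
  have all: "(\<forall>r\<in>carrier R. P r) \<longleftrightarrow> (\<forall>r\<in>carrier R. P (\<sigma> r))" for P
    by (subst img) simp
  show ?thesis
    unfolding central_regular_def regular_element_def mem_Collect_eq
    using assms(2)
    by (subst (1 2 3) all)
       (simp add: m mul[symmetric] eq eq[of _ \<zero>, unfolded z])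
qed

lemma localization_map_frac:
  assumes "\<sigma> \<in> ring_iso R R" "u \<in> cr" "r \<in> carrier R"
  shows "localization_map R cr \<sigma> (frac R cr u r) = frac R cr (\<sigma> u) (\<sigma> r)"
proof -
  have m: "\<And>x. x \<in> carrier R \<Longrightarrow> \<sigma> x \<in> carrier R"
    and mul: "\<And>x y. x \<in> carrier R \<Longrightarrow> y \<in> carrier R \<Longrightarrow> \<sigma> (x \<otimes> y) = \<sigma> x \<otimes> \<sigma> y"
    using assms(1) by (auto simp: ring_iso_def ring_hom_def)
  have "frac R cr (\<sigma> v) (\<sigma> s) = frac R cr (\<sigma> u) (\<sigma> r)" if "(v, s) \<in> frac R cr u r" for v s
  proof -
    note h = frac_memD[OF that]
    have "\<sigma> u \<otimes> \<sigma> s = \<sigma> v \<otimes> \<sigma> r"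
      using h(1-4) by (simp add: cr_carrier h(5) flip: mul)
    then show ?thesis
      using h(1-4) by (intro frac_eq_iff[THEN iffD2]) (simp_all add: cr_carrier m ring_iso_cr[OF assms(1)])
  qed
  then show ?thesis
    unfolding localization_map_def by (rule UN_pair_const[OF frac_self[OF assms(2,3)]])
qed

theorem localization_map_iso:
  assumes "\<sigma> \<in> ring_iso R R"
  shows "localization_map R cr \<sigma> \<in> ring_iso L L"
proof -
  have b: "bij_betw \<sigma> (carrier R) (carrier R)" and m: "\<And>x. x \<in> carrier R \<Longrightarrow> \<sigma> x \<in> carrier R"
    and mul: "\<And>x y. x \<in> carrier R \<Longrightarrow> y \<in> carrier R \<Longrightarrow> \<sigma> (x \<otimes> y) = \<sigma> x \<otimes> \<sigma> y"
    and add: "\<And>x y. x \<in> carrier R \<Longrightarrow> y \<in> carrier R \<Longrightarrow> \<sigma> (x \<oplus> y) = \<sigma> x \<oplus> \<sigma> y"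
    and one: "\<sigma> \<one> = \<one>"
    using assms by (auto simp: ring_iso_def ring_hom_def)
  have crs: "\<And>u. u \<in> cr \<Longrightarrow> \<sigma> u \<in> cr" using ring_iso_cr[OF assms] cr_carrier by blast
  have eq: "\<sigma> x = \<sigma> y \<longleftrightarrow> x = y" if "x \<in> carrier R" "y \<in> carrier R" for x y
    using b that by (meson bij_betw_def inj_on_eq_iff)
  note simps = localization_map_frac[OF assms] frac_mult frac_add frac_closed cr_mult cr_carrier
    m crs mul add one
  let ?f = "localization_map R cr \<sigma>"
  have closed: "?f X \<in> carrier L" if "X \<in> carrier L" for X
    using that by (auto elim!: localizationE simp: simps)
  have hom: "?f \<in> ring_hom L L"
  proof (rule ring_hom_memI)
    fix X Y assume "X \<in> carrier L" "Y \<in> carrier L"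
    then show "?f (X \<otimes>\<^bsub>L\<^esub> Y) = ?f X \<otimes>\<^bsub>L\<^esub> ?f Y" "?f (X \<oplus>\<^bsub>L\<^esub> Y) = ?f X \<oplus>\<^bsub>L\<^esub> ?f Y"
      by (auto elim!: localizationE simp: simps)
  qed (auto simp: closed simps localization_one cr_one)
  have "inj_on ?f (carrier L)"
  proof (rule inj_onI)
    fix X Y assume "X \<in> carrier L" "Y \<in> carrier L" "?f X = ?f Y"
    then obtain u r v s where h: "u \<in> cr" "r \<in> carrier R" "X = frac R cr u r"
       "v \<in> cr" "s \<in> carrier R" "Y = frac R cr v s" "?f X = ?f Y" by (metis localizationE)
    then have "\<sigma> (v \<otimes> r) = \<sigma> (u \<otimes> s)"
      by (simp add: simps frac_eq_iff)
    then show "X = Y" using h by (simp add: frac_eq_iff eq cr_carrier)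
  qed
  moreover have "X \<in> ?f ` carrier L" if X: "X \<in> carrier L" for X
  proof -
    from X obtain u r where h: "u \<in> cr" "r \<in> carrier R" "X = frac R cr u r"
      by (metis localizationE)
    from h b cr_carrier obtain u' r' where h': "u' \<in> carrier R" "\<sigma> u' = u" "r' \<in> carrier R" "\<sigma> r' = r"
      by (metis bij_betw_def imageE)
    then have u': "u' \<in> cr" using h(1) ring_iso_cr[OF assms h'(1)] by simp
    then have "X = ?f (frac R cr u' r')" using h h' by (simp add: simps)
    then show ?thesis using u' h' frac_closed by blast
  qed
  ultimately show ?thesis
    using hom closed by (auto simp: ring_iso_def bij_betw_def)
qed

theorem ring_skew_poly_ring:
  assumes "\<tau> \<in> ring_hom R R"
  shows "ring (skew_poly_ring R \<tau>)"
proof -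
  let ?P = "skew_poly_ring R \<tau>"
  have pow: "\<tau> ^^ i \<in> ring_hom R R" for i
    by (induction i) (use assms in \<open>auto simp: ring_hom_def Pi_iff\<close>)
  have cl: "(\<tau> ^^ i) x \<in> carrier R" if "x \<in> carrier R" for i x
    using ring_hom_closed[OF pow that] .
  have mul: "(\<tau> ^^ i) (x \<otimes> y) = (\<tau> ^^ i) x \<otimes> (\<tau> ^^ i) y"
    if "x \<in> carrier R" "y \<in> carrier R" for i x y
    using ring_hom_mult[OF pow that] .
  have add: "(\<tau> ^^ i) (x \<oplus> y) = (\<tau> ^^ i) x \<oplus> (\<tau> ^^ i) y"
    if "x \<in> carrier R" "y \<in> carrier R" for i x y
    using ring_hom_add[OF pow that] .
  have one: "(\<tau> ^^ i) \<one> = \<one>" for i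
    using ring_hom_one[OF pow] .
  have zero: "(\<tau> ^^ i) \<zero> = \<zero>" for i
    using ring_hom_zero[OF pow ring_axioms ring_axioms] .
  have sum: "(\<tau> ^^ i) (\<Oplus>j\<in>{..k}. f j) = (\<Oplus>j\<in>{..k}. (\<tau> ^^ i) (f j))"
    if "\<And>j. f j \<in> carrier R" for i f and k :: nat
    by (induction k) (simp_all add: that cl add Pi_def)
  have mc: "p \<otimes>\<^bsub>?P\<^esub> q \<in> up R" if pq: "p \<in> up R" "q \<in> up R" for p q
  proof
    show "(p \<otimes>\<^bsub>?P\<^esub> q) n \<in> carrier R" for n
      using pq by (auto simp: skew_poly_ring_def Pi_def cl mem_upD)
    from pq obtain n m where n: "bound \<zero> n p" and m: "bound \<zero> m q" by blast
    have "bound \<zero> (n + m) (p \<otimes>\<^bsub>?P\<^esub> q)"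
    proof
      fix k assume k: "n + m < k"
      have "p i \<otimes> (\<tau> ^^ i) (q (k - i)) = \<zero>" for i
      proof (cases "n < i")
        case True
        then have "p i = \<zero>" using n by auto
        then show ?thesis using pq by (simp add: cl mem_upD)
      next
        case False
        then have "m < k - i" using k by arith
        then have "q (k - i) = \<zero>" using m by auto
        then show ?thesis using pq by (simp add: zero mem_upD)
      qed
      then show "(p \<otimes>\<^bsub>?P\<^esub> q) k = \<zero>" by (simp add: skew_poly_ring_def)
    qed
    then show "\<exists>n. bound \<zero> n (p \<otimes>\<^bsub>?P\<^esub> q)" ..
  qed
  have assoc: "(\<Oplus>j\<in>{..k}. (\<Oplus>i\<in>{..j}. a i \<otimes> b i (j - i)) \<otimes> c j (n - j))
      = (\<Oplus>j\<in>{..k}. a j \<otimes> (\<Oplus>i\<in>{..k - j}. b j i \<otimes> c (j + i) (n - j - i)))"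
    if "k \<le> n" "\<And>i. a i \<in> carrier R" "\<And>i j. b i j \<in> carrier R" "\<And>i j. c i j \<in> carrier R"
    for a b c and k n :: nat
    using that(1)
  proof (induction k)
    case 0
    then show ?case by (simp add: that Pi_def m_assoc)
  next
    case (Suc k)
    then have "k \<le> n" by arith
    from this have "(\<Oplus>j\<in>{..k}. (\<Oplus>i\<in>{..j}. a i \<otimes> b i (j - i)) \<otimes> c j (n - j))
      = (\<Oplus>j\<in>{..k}. a j \<otimes> (\<Oplus>i\<in>{..k - j}. b j i \<otimes> c (j + i) (n - j - i)))" by (rule Suc.IH)
    with that(2-) show ?case
      by (simp cong: finsum_cong add: Suc_diff_le Pi_def l_distr r_distr m_assoc)
         (simp cong: finsum_cong add: Pi_def a_ac finsum_ldistr m_assoc)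
  qed
  have carr: "carrier ?P = up R" by (simp add: skew_poly_ring_def)
  show ?thesis
  proof (rule ringI)
    show "abelian_group ?P"
    proof (rule abelian_groupI)
      fix p assume p: "p \<in> carrier ?P"
      show "\<exists>q\<in>carrier ?P. q \<oplus>\<^bsub>?P\<^esub> p = \<zero>\<^bsub>?P\<^esub>"
        using p by (intro bexI[of _ "\<lambda>i. \<ominus> p i"])
          (auto simp: skew_poly_ring_def up_a_inv_closed l_neg mem_upD)
    qed (auto simp: skew_poly_ring_def up_add_closed a_ac mem_upD)
    show "monoid ?P"
    proof (rule monoidI)
      show "\<one>\<^bsub>?P\<^esub> \<in> carrier ?P" using up_one_closed by (simp add: skew_poly_ring_def)
    next
      fix p q r assume h: "p \<in> carrier ?P" "q \<in> carrier ?P" "r \<in> carrier ?P"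
      then have c: "\<And>i. p i \<in> carrier R" "\<And>i. q i \<in> carrier R" "\<And>i. r i \<in> carrier R"
        by (auto simp: carr)
      show "(p \<otimes>\<^bsub>?P\<^esub> q) \<otimes>\<^bsub>?P\<^esub> r = p \<otimes>\<^bsub>?P\<^esub> (q \<otimes>\<^bsub>?P\<^esub> r)"
      proof
        fix n
        have "(p \<otimes>\<^bsub>?P\<^esub> (q \<otimes>\<^bsub>?P\<^esub> r)) n
           = (\<Oplus>j\<in>{..n}. p j \<otimes> (\<Oplus>i\<in>{..n - j}. (\<tau> ^^ j) (q i) \<otimes> (\<tau> ^^ (j + i)) (r (n - j - i))))"
          by (simp add: skew_poly_ring_def sum mul cl c funpow_add)
        then show "((p \<otimes>\<^bsub>?P\<^esub> q) \<otimes>\<^bsub>?P\<^esub> r) n = (p \<otimes>\<^bsub>?P\<^esub> (q \<otimes>\<^bsub>?P\<^esub> r)) n"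
          using assoc[of n n p "\<lambda>i j. (\<tau> ^^ i) (q j)" "\<lambda>i j. (\<tau> ^^ i) (r j)"] c
          by (simp add: skew_poly_ring_def cl)
      qed
    next
      fix p assume "p \<in> carrier ?P"
      then have c: "\<And>i. p i \<in> carrier R" by (auto simp: carr)
      show "\<one>\<^bsub>?P\<^esub> \<otimes>\<^bsub>?P\<^esub> p = p"
      proof
        fix n
        have "(\<one>\<^bsub>?P\<^esub> \<otimes>\<^bsub>?P\<^esub> p) n = (\<Oplus>i\<in>{..n}. if i = 0 then p n else \<zero>)"
          by (auto simp: skew_poly_ring_def Pi_def cl c intro!: finsum_cong')
        also have "\<dots> = p n"
          using finsum_singleton[of 0 "{..n}" "\<lambda>_. p n"] c by (simp add: eq_commute)
        finally show "(\<one>\<^bsub>?P\<^esub> \<otimes>\<^bsub>?P\<^esub> p) n = p n" .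
      qed
      show "p \<otimes>\<^bsub>?P\<^esub> \<one>\<^bsub>?P\<^esub> = p"
      proof
        fix n
        have "(p \<otimes>\<^bsub>?P\<^esub> \<one>\<^bsub>?P\<^esub>) n = (\<Oplus>i\<in>{..n}. if n = i then p i else \<zero>)"
          by (auto simp: skew_poly_ring_def Pi_def cl c one zero intro!: finsum_cong')
        also have "\<dots> = p n"
          using finsum_singleton[of n "{..n}" p] c by simp
        finally show "(p \<otimes>\<^bsub>?P\<^esub> \<one>\<^bsub>?P\<^esub>) n = p n" .
      qed
    qed (simp add: mc carr)
  qed (auto simp: skew_poly_ring_def Pi_def cl add l_distr r_distr mem_upD
        cong: finsum_cong intro!: ext)
qed

end

end

theory Submission
  imports Defs
begin

text \<open>
  Let \<open>A = R[x;\<sigma>]\<close> and \<open>B = (\<Delta>\<^sup>-\<^sup>1R)[x;\<sigma>']\<close>, so that \<open>A\<close> embeds in \<open>B\<close>; symmetry passes to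
  subrings.  Conversely, suppose that \<open>A\<close> is symmetric.  If \<open>d \<in> \<Delta>\<close>, then \<open>p q = 0\<close> iff
  \<open>p d q = 0\<close> in \<open>A\<close>, since \<open>p d q = 0\<close> gives \<open>p q d = 0\<close> and \<open>d\<close> is regular.  Because every
  element of \<open>B\<close> can be moved into \<open>A\<close> by an element of \<open>\<Delta>\<close> on the left, and by one on
  the right (here surjectivity of \<open>\<sigma>\<close> enters), the same equivalence holds in \<open>B\<close>.  Hence if
  \<open>u F\<close>, \<open>v G\<close>, \<open>w H\<close> lie in \<open>A\<close>, then \<open>F G H = 0\<close> iff \<open>(u F) (v G) (w H) = 0\<close>.
\<close>

section \<open>Symmetric rings and embeddings\<close>

lemma symmetric_ringD:
  assumes "symmetric_ring R" "a \<in> carrier R" "b \<in> carrier R" "c \<in> carrier R"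
    "a \<otimes>\<^bsub>R\<^esub> b \<otimes>\<^bsub>R\<^esub> c = \<zero>\<^bsub>R\<^esub>"
  shows "a \<otimes>\<^bsub>R\<^esub> c \<otimes>\<^bsub>R\<^esub> b = \<zero>\<^bsub>R\<^esub>"
  using assms unfolding symmetric_ring_def by blast

lemma (in ring) regular_element_left_iff:
  assumes "regular_element R u" "u \<in> carrier R" "r \<in> carrier R"
  shows "u \<otimes> r = \<zero> \<longleftrightarrow> r = \<zero>"
  using assms r_null[OF assms(2)] unfolding regular_element_def by blast

lemma (in ring) regular_element_right_iff:
  assumes "regular_element R u" "u \<in> carrier R" "r \<in> carrier R"
  shows "r \<otimes> u = \<zero> \<longleftrightarrow> r = \<zero>"
  using assms l_null[OF assms(2)] unfolding regular_element_def by blast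

text \<open>Symmetry used in both directions makes \<open>p d q = 0\<close> equivalent to
  \<open>p q d = 0\<close>, and there \<open>d\<close> cancels on the right. The hypothesis is
  regularity rather than centrality because a constant from \<open>cr\<close> commutes with
  \<open>x\<close> only when \<open>\<sigma>\<close> fixes it.\<close>

lemma (in ring) symmetric_ring_insert_regular:
  assumes "symmetric_ring R" "regular_element R d"
    and c: "p \<in> carrier R" "d \<in> carrier R" "q \<in> carrier R"
  shows "p \<otimes> d \<otimes> q = \<zero> \<longleftrightarrow> p \<otimes> q = \<zero>"
proof -
  have "p \<otimes> d \<otimes> q = \<zero> \<longleftrightarrow> p \<otimes> q \<otimes> d = \<zero>"
    using symmetric_ringD[OF assms(1)] c by blast
  then show ?thesis
    using regular_element_right_iff[OF assms(2) c(2)] c by simp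
qed

section \<open>Properties reflected by injective homomorphisms\<close>

lemma (in ring_hom_ring) inj_hom_zero_iff:
  assumes "inj_on h (carrier R)" "a \<in> carrier R"
  shows "h a = \<zero>\<^bsub>S\<^esub> \<longleftrightarrow> a = \<zero>"
  using inj_on_eq_iff[OF assms(1), of a \<zero>] assms(2) by simp

text \<open>An equation \<open>d r = 0\<close> or \<open>r d = 0\<close> is pushed into
  \<open>S\<close>, cancelled there, and pulled back by injectivity.\<close>

lemma (in ring_hom_ring) inj_hom_regular_element:
  assumes "inj_on h (carrier R)" "d \<in> carrier R" "regular_element S (h d)"
  shows "regular_element R d"
  unfolding regular_element_def
proof (intro conjI ballI impI)
  fix r assume r: "r \<in> carrier R"
  show "r = \<zero>" if "d \<otimes> r = \<zero>"
  proof -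
    have "h d \<otimes>\<^bsub>S\<^esub> h r = \<zero>\<^bsub>S\<^esub>" using that r assms(2) by (simp flip: hom_mult)
    then show ?thesis
      using S.regular_element_left_iff[OF assms(3)] inj_hom_zero_iff[OF assms(1)] assms(2) r by simp
  qed
  show "r = \<zero>" if "r \<otimes> d = \<zero>"
  proof -
    have "h r \<otimes>\<^bsub>S\<^esub> h d = \<zero>\<^bsub>S\<^esub>" using that r assms(2) by (simp flip: hom_mult)
    then show ?thesis
      using S.regular_element_right_iff[OF assms(3)] inj_hom_zero_iff[OF assms(1)] assms(2) r by simp
  qed
qed

lemma (in ring_hom_ring) inj_hom_symmetric_ring:
  assumes "inj_on h (carrier R)" "symmetric_ring S"
  shows "symmetric_ring R"
  unfolding symmetric_ring_def
proof (intro ballI impI)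
  fix a b c assume c: "a \<in> carrier R" "b \<in> carrier R" "c \<in> carrier R" and z: "a \<otimes> b \<otimes> c = \<zero>"
  have "h a \<otimes>\<^bsub>S\<^esub> h b \<otimes>\<^bsub>S\<^esub> h c = \<zero>\<^bsub>S\<^esub>" using c z by (simp flip: hom_mult)
  then have "h (a \<otimes> c \<otimes> b) = \<zero>\<^bsub>S\<^esub>" using c symmetric_ringD[OF assms(2), of "h a" "h b" "h c"] by simp
  then show "a \<otimes> c \<otimes> b = \<zero>" using inj_hom_zero_iff[OF assms(1), of "a \<otimes> c \<otimes> b"] c by simp
qed

text \<open>The abstract form of the hard direction, to be used with \<open>D\<close> the constants
  from \<Delta>. Denominators are asked for on both sides so that a product \<open>P d Q\<close> can
  be moved into the image of \<open>h\<close> from its outer ends, without disturbing the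
  \<open>d\<close> in the middle.\<close>

lemma (in ring_hom_ring) symmetric_ring_clear_denominators:
  assumes inj: "inj_on h (carrier R)" and sym: "symmetric_ring R"
    and D: "D \<subseteq> carrier R" "\<And>d. d \<in> D \<Longrightarrow> regular_element S (h d)"
    and left: "\<And>b. b \<in> carrier S \<Longrightarrow> \<exists>d\<in>D. h d \<otimes>\<^bsub>S\<^esub> b \<in> h ` carrier R"
    and right: "\<And>b. b \<in> carrier S \<Longrightarrow> \<exists>d\<in>D. b \<otimes>\<^bsub>S\<^esub> h d \<in> h ` carrier R"
  shows "symmetric_ring S"
proof -
  have DR: "d \<in> carrier R" "h d \<in> carrier S" if "d \<in> D" for d using D(1) that by auto
  note lreg = S.regular_element_left_iff[OF D(2) DR(2)]
    and rreg = S.regular_element_right_iff[OF D(2) DR(2)]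
  \<comment> \<open>Insertion of a regular element is carried over from \<open>R\<close> to
    \<open>S\<close>: \<open>u\<close> clears \<open>P\<close> on the left, \<open>t\<close> clears
    \<open>Q\<close> on the right, and the claim becomes the one for \<open>p\<close> and
    \<open>q\<close> in \<open>R\<close>.\<close>
  have ins: "P \<otimes>\<^bsub>S\<^esub> h d \<otimes>\<^bsub>S\<^esub> Q = \<zero>\<^bsub>S\<^esub> \<longleftrightarrow> P \<otimes>\<^bsub>S\<^esub> Q = \<zero>\<^bsub>S\<^esub>"
    if PQ: "P \<in> carrier S" "Q \<in> carrier S" and d: "d \<in> D" for P Q d
  proof -
    from left[OF PQ(1)] obtain u p where u: "u \<in> D" "p \<in> carrier R" "h u \<otimes>\<^bsub>S\<^esub> P = h p" by auto
    from right[OF PQ(2)] obtain t q where t: "t \<in> D" "q \<in> carrier R" "Q \<otimes>\<^bsub>S\<^esub> h t = h q" by auto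
    have "P \<otimes>\<^bsub>S\<^esub> h d \<otimes>\<^bsub>S\<^esub> Q = \<zero>\<^bsub>S\<^esub> \<longleftrightarrow>
        h u \<otimes>\<^bsub>S\<^esub> (P \<otimes>\<^bsub>S\<^esub> h d \<otimes>\<^bsub>S\<^esub> Q) \<otimes>\<^bsub>S\<^esub> h t = \<zero>\<^bsub>S\<^esub>"
      using PQ DR[OF d] DR[OF u(1)] DR[OF t(1)] by (simp add: lreg[OF u(1) u(1)] rreg[OF t(1) t(1)])
    also have "h u \<otimes>\<^bsub>S\<^esub> (P \<otimes>\<^bsub>S\<^esub> h d \<otimes>\<^bsub>S\<^esub> Q) \<otimes>\<^bsub>S\<^esub> h t
        = (h u \<otimes>\<^bsub>S\<^esub> P) \<otimes>\<^bsub>S\<^esub> h d \<otimes>\<^bsub>S\<^esub> (Q \<otimes>\<^bsub>S\<^esub> h t)"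
      using PQ DR[OF d] DR[OF u(1)] DR[OF t(1)] by (simp add: S.m_assoc)
    also have "\<dots> = h (p \<otimes> d \<otimes> q)" using u t DR[OF d] by simp
    also have "\<dots> = \<zero>\<^bsub>S\<^esub> \<longleftrightarrow> p \<otimes> d \<otimes> q = \<zero>"
      using inj_hom_zero_iff[OF inj, of "p \<otimes> d \<otimes> q"] u t DR[OF d] by simp
    also have "\<dots> \<longleftrightarrow> p \<otimes> q = \<zero>"
      using R.symmetric_ring_insert_regular[OF sym inj_hom_regular_element[OF inj DR(1)[OF d] D(2)[OF d]]]
        u(2) t(2) DR(1)[OF d] by blast
    also have "\<dots> \<longleftrightarrow> h (p \<otimes> q) = \<zero>\<^bsub>S\<^esub>"
      using inj_hom_zero_iff[OF inj, of "p \<otimes> q"] u t by simp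
    also have "h (p \<otimes> q) = h u \<otimes>\<^bsub>S\<^esub> (P \<otimes>\<^bsub>S\<^esub> Q) \<otimes>\<^bsub>S\<^esub> h t"
      using PQ DR[OF u(1)] DR[OF t(1)] u(2) t(2) by (simp add: u(3)[symmetric] t(3)[symmetric] S.m_assoc)
    also have "\<dots> = \<zero>\<^bsub>S\<^esub> \<longleftrightarrow> P \<otimes>\<^bsub>S\<^esub> Q = \<zero>\<^bsub>S\<^esub>"
      using PQ DR[OF u(1)] DR[OF t(1)] by (simp add: lreg[OF u(1) u(1)] rreg[OF t(1) t(1)])
    finally show ?thesis .
  qed
  have clear: "F \<otimes>\<^bsub>S\<^esub> G \<otimes>\<^bsub>S\<^esub> H = \<zero>\<^bsub>S\<^esub> \<longleftrightarrow> f \<otimes> g \<otimes> k = \<zero>"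
    if FGH: "F \<in> carrier S" "G \<in> carrier S" "H \<in> carrier S"
      and fgk: "f \<in> carrier R" "g \<in> carrier R" "k \<in> carrier R"
      and uvw: "u \<in> D" "v \<in> D" "w \<in> D"
      and eq: "h u \<otimes>\<^bsub>S\<^esub> F = h f" "h v \<otimes>\<^bsub>S\<^esub> G = h g" "h w \<otimes>\<^bsub>S\<^esub> H = h k"
    for F G H f g k u v w
  proof -
    note c = DR[OF uvw(1)] DR[OF uvw(2)] DR[OF uvw(3)]
    \<comment> \<open>\<open>h w\<close> and \<open>h v\<close> are inserted directly before
      \<open>H\<close> and \<open>G\<close>, and \<open>h u\<close> is multiplied on in front. Every
      factor then stands next to the element that clears it.\<close>
    have "F \<otimes>\<^bsub>S\<^esub> G \<otimes>\<^bsub>S\<^esub> H = \<zero>\<^bsub>S\<^esub> \<longleftrightarrow> F \<otimes>\<^bsub>S\<^esub> G \<otimes>\<^bsub>S\<^esub> h w \<otimes>\<^bsub>S\<^esub> H = \<zero>\<^bsub>S\<^esub>"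
      using ins[of "F \<otimes>\<^bsub>S\<^esub> G" H w] FGH uvw by simp
    also have "\<dots> \<longleftrightarrow> F \<otimes>\<^bsub>S\<^esub> (G \<otimes>\<^bsub>S\<^esub> h w \<otimes>\<^bsub>S\<^esub> H) = \<zero>\<^bsub>S\<^esub>"
      using FGH c by (simp add: S.m_assoc)
    also have "\<dots> \<longleftrightarrow> F \<otimes>\<^bsub>S\<^esub> h v \<otimes>\<^bsub>S\<^esub> (G \<otimes>\<^bsub>S\<^esub> h w \<otimes>\<^bsub>S\<^esub> H) = \<zero>\<^bsub>S\<^esub>"
      using ins[of F "G \<otimes>\<^bsub>S\<^esub> h w \<otimes>\<^bsub>S\<^esub> H" v] FGH c uvw by simp
    also have "\<dots> \<longleftrightarrow> h u \<otimes>\<^bsub>S\<^esub> (F \<otimes>\<^bsub>S\<^esub> h v \<otimes>\<^bsub>S\<^esub> (G \<otimes>\<^bsub>S\<^esub> h w \<otimes>\<^bsub>S\<^esub> H)) = \<zero>\<^bsub>S\<^esub>"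
      using FGH c by (simp add: lreg[OF uvw(1) uvw(1)])
    also have "h u \<otimes>\<^bsub>S\<^esub> (F \<otimes>\<^bsub>S\<^esub> h v \<otimes>\<^bsub>S\<^esub> (G \<otimes>\<^bsub>S\<^esub> h w \<otimes>\<^bsub>S\<^esub> H))
        = (h u \<otimes>\<^bsub>S\<^esub> F) \<otimes>\<^bsub>S\<^esub> (h v \<otimes>\<^bsub>S\<^esub> G) \<otimes>\<^bsub>S\<^esub> (h w \<otimes>\<^bsub>S\<^esub> H)"
      using FGH c by (simp add: S.m_assoc)
    also have "\<dots> = h (f \<otimes> g \<otimes> k)" using fgk by (simp add: eq)
    also have "\<dots> = \<zero>\<^bsub>S\<^esub> \<longleftrightarrow> f \<otimes> g \<otimes> k = \<zero>"
      using inj_hom_zero_iff[OF inj, of "f \<otimes> g \<otimes> k"] fgk by simp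
    finally show ?thesis .
  qed
  show ?thesis
    unfolding symmetric_ring_def
  proof (intro ballI impI)
    fix F G H assume FGH: "F \<in> carrier S" "G \<in> carrier S" "H \<in> carrier S"
      and z: "F \<otimes>\<^bsub>S\<^esub> G \<otimes>\<^bsub>S\<^esub> H = \<zero>\<^bsub>S\<^esub>"
    from left[OF FGH(1)] obtain u f where u: "u \<in> D" "f \<in> carrier R" "h u \<otimes>\<^bsub>S\<^esub> F = h f" by auto
    from left[OF FGH(2)] obtain v g where v: "v \<in> D" "g \<in> carrier R" "h v \<otimes>\<^bsub>S\<^esub> G = h g" by auto
    from left[OF FGH(3)] obtain w k where w: "w \<in> D" "k \<in> carrier R" "h w \<otimes>\<^bsub>S\<^esub> H = h k" by auto
    have "f \<otimes> g \<otimes> k = \<zero>" using clear[of F G H f g k u v w] FGH u v w z by simp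
    then have "f \<otimes> k \<otimes> g = \<zero>" using symmetric_ringD[OF sym u(2) v(2) w(2)] by blast
    \<comment> \<open>Each numerator depends on its own factor only, so \<open>clear\<close> applies
      again with \<open>G\<close> and \<open>H\<close> exchanged and the same \<open>f\<close>,
      \<open>g\<close>, \<open>k\<close>.\<close>
    then show "F \<otimes>\<^bsub>S\<^esub> H \<otimes>\<^bsub>S\<^esub> G = \<zero>\<^bsub>S\<^esub>"
      using clear[of F H G f k g u w v] FGH u v w by simp
  qed
qed


section \<open>Skew polynomials\<close>

lemma funpow_ring_hom: "\<tau> \<in> ring_hom R R \<Longrightarrow> \<tau> ^^ i \<in> ring_hom R R"
  by (induction i) (auto simp: ring_hom_def Pi_iff)

lemma carrier_skew_poly_ring: "carrier (skew_poly_ring R \<tau>) = up R"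
  by (simp add: skew_poly_ring_def)

lemma zero_skew_poly_ring: "\<zero>\<^bsub>skew_poly_ring R \<tau>\<^esub> = (\<lambda>n. \<zero>\<^bsub>R\<^esub>)"
  by (simp add: skew_poly_ring_def)

section \<open>Multiplication by constant skew polynomials\<close>

definition skew_const :: "('a, 'm) ring_scheme \<Rightarrow> 'a \<Rightarrow> nat \<Rightarrow> 'a" where
  "skew_const R d = (\<lambda>n. if n = 0 then d else \<zero>\<^bsub>R\<^esub>)"

context ring
begin

lemma skew_const_closed: "d \<in> carrier R \<Longrightarrow> skew_const R d \<in> up R"
  by (auto simp: skew_const_def up_def bound_def)

lemma skew_const_mult:
  assumes "\<tau> \<in> ring_hom R R" "d \<in> carrier R" "p \<in> up R"
  shows "skew_const R d \<otimes>\<^bsub>skew_poly_ring R \<tau>\<^esub> p = (\<lambda>n. d \<otimes> p n)"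
proof
  fix n
  have cl: "(\<tau> ^^ i) x \<in> carrier R" if "x \<in> carrier R" for i x
    using ring_hom_closed[OF funpow_ring_hom[OF assms(1)] that] .
  have "(skew_const R d \<otimes>\<^bsub>skew_poly_ring R \<tau>\<^esub> p) n = (\<Oplus>i\<in>{..n}. if 0 = i then d \<otimes> p n else \<zero>)"
    using assms by (auto simp: skew_poly_ring_def skew_const_def Pi_def cl mem_upD intro!: finsum_cong')
  also have "\<dots> = d \<otimes> p n"
    using finsum_singleton[of 0 "{..n}" "\<lambda>_. d \<otimes> p n"] assms by (simp add: mem_upD)
  finally show "(skew_const R d \<otimes>\<^bsub>skew_poly_ring R \<tau>\<^esub> p) n = d \<otimes> p n" .
qed

text \<open>Since \<open>x^n d = \<tau>^n(d) x^n\<close>, multiplying by a constant on the right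
  scales each degree by a different element. This twist is what the family \<open>\<phi>\<close> in
  \<open>common_denominator\<close> has to absorb.\<close>

lemma mult_skew_const:
  assumes "\<tau> \<in> ring_hom R R" "d \<in> carrier R" "p \<in> up R"
  shows "p \<otimes>\<^bsub>skew_poly_ring R \<tau>\<^esub> skew_const R d = (\<lambda>n. p n \<otimes> (\<tau> ^^ n) d)"
proof
  fix n
  have cl: "(\<tau> ^^ i) x \<in> carrier R" if "x \<in> carrier R" for i x
    using ring_hom_closed[OF funpow_ring_hom[OF assms(1)] that] .
  have zero: "(\<tau> ^^ i) \<zero> = \<zero>" for i
    using ring_hom_zero[OF funpow_ring_hom[OF assms(1)] ring_axioms ring_axioms] .
  \<comment> \<open>The coefficient of \<open>skew_const R d\<close> at \<open>n - i\<close>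
    vanishes unless \<open>i = n\<close>, and by \<open>zero\<close> it stays zero under
    \<open>\<tau> ^^ i\<close>.\<close>
  have "(p \<otimes>\<^bsub>skew_poly_ring R \<tau>\<^esub> skew_const R d) n
      = (\<Oplus>i\<in>{..n}. if n = i then p i \<otimes> (\<tau> ^^ i) d else \<zero>)"
    using assms by (auto simp: skew_poly_ring_def skew_const_def Pi_def cl zero mem_upD intro!: finsum_cong')
  also have "\<dots> = p n \<otimes> (\<tau> ^^ n) d"
    using finsum_singleton[of n "{..n}" "\<lambda>i. p i \<otimes> (\<tau> ^^ i) d"] assms by (simp add: mem_upD cl)
  finally show "(p \<otimes>\<^bsub>skew_poly_ring R \<tau>\<^esub> skew_const R d) n = p n \<otimes> (\<tau> ^^ n) d" .
qed

end

section \<open>Change of the coefficient ring\<close>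

lemma (in ring_hom_ring) funpow_intertwine:
  assumes "\<tau> \<in> ring_hom R R" "\<And>x. x \<in> carrier R \<Longrightarrow> h (\<tau> x) = \<tau>' (h x)" "x \<in> carrier R"
  shows "h ((\<tau> ^^ i) x) = (\<tau>' ^^ i) (h x)"
  using ring_hom_closed[OF funpow_ring_hom[OF assms(1)] assms(3)] assms(2)
  by (induction i) auto

text \<open>Because \<open>h\<close> intertwines all powers of \<open>\<tau>\<close> and
  \<open>\<tau>'\<close>, it sends each summand of a product coefficient to the corresponding
  summand over \<open>S\<close>.\<close>

lemma (in ring_hom_ring) skew_poly_ring_hom:
  assumes t: "\<tau> \<in> ring_hom R R" and t': "\<tau>' \<in> ring_hom S S"
    and comm: "\<And>x. x \<in> carrier R \<Longrightarrow> h (\<tau> x) = \<tau>' (h x)"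
  shows "ring_hom_ring (skew_poly_ring R \<tau>) (skew_poly_ring S \<tau>') (\<lambda>p. h \<circ> p)"
proof (intro ring_hom_ringI2 R.ring_skew_poly_ring[OF t] S.ring_skew_poly_ring[OF t'] ring_hom_memI)
  have cl: "(\<tau> ^^ i) x \<in> carrier R" if "x \<in> carrier R" for i x
    using ring_hom_closed[OF funpow_ring_hom[OF t] that] .
  have hpow: "h ((\<tau> ^^ i) x) = (\<tau>' ^^ i) (h x)" if "x \<in> carrier R" for i x
    using t comm that by (rule funpow_intertwine)
  fix p assume "p \<in> carrier (skew_poly_ring R \<tau>)"
  then have p: "p \<in> up R" by (simp add: carrier_skew_poly_ring)
  then obtain n where "bound \<zero> n p" by blast
  then have "bound \<zero>\<^bsub>S\<^esub> n (h \<circ> p)" by (auto simp: bound_def)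
  then show "h \<circ> p \<in> carrier (skew_poly_ring S \<tau>')"
    using p unfolding carrier_skew_poly_ring by (intro mem_upI exI) (simp_all add: mem_upD)
  fix q assume "q \<in> carrier (skew_poly_ring R \<tau>)"
  then have q: "q \<in> up R" by (simp add: carrier_skew_poly_ring)
  show "h \<circ> (p \<otimes>\<^bsub>skew_poly_ring R \<tau>\<^esub> q)
      = (h \<circ> p) \<otimes>\<^bsub>skew_poly_ring S \<tau>'\<^esub> (h \<circ> q)"
  proof
    fix n
    have "h (\<Oplus>i\<in>{..n}. p i \<otimes> (\<tau> ^^ i) (q (n - i)))
        = (\<Oplus>\<^bsub>S\<^esub>i\<in>{..n}. h (p i) \<otimes>\<^bsub>S\<^esub> (\<tau>' ^^ i) (h (q (n - i))))"
      using p q by (subst hom_finsum) (auto simp: mem_upD cl o_def simp flip: hpow intro!: S.finsum_cong')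
    then show "(h \<circ> (p \<otimes>\<^bsub>skew_poly_ring R \<tau>\<^esub> q)) n
        = ((h \<circ> p) \<otimes>\<^bsub>skew_poly_ring S \<tau>'\<^esub> (h \<circ> q)) n"
      by (simp add: skew_poly_ring_def)
  qed
  show "h \<circ> (p \<oplus>\<^bsub>skew_poly_ring R \<tau>\<^esub> q)
      = (h \<circ> p) \<oplus>\<^bsub>skew_poly_ring S \<tau>'\<^esub> (h \<circ> q)"
    using p q by (auto simp: skew_poly_ring_def mem_upD)
qed (auto simp: skew_poly_ring_def)

lemma inj_on_comp_up:
  assumes "inj_on h (carrier R)"
  shows "inj_on (\<lambda>p. h \<circ> p) (up R)"
proof (intro inj_onI ext)
  fix p q n assume "p \<in> up R" "q \<in> up R" "h \<circ> p = h \<circ> q"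
  then show "p n = q n"
    using inj_onD[OF assms, of "p n" "q n"] by (auto simp: mem_upD dest: fun_cong[of _ _ n])
qed

text \<open>Coefficients are lifted one at a time; the lift has finite support because, by
  injectivity, zero lifts only to zero.\<close>

lemma (in ring_hom_ring) up_comp_image:
  assumes "inj_on h (carrier R)" "p \<in> up S" "\<And>n. p n \<in> h ` carrier R"
  shows "p \<in> (\<lambda>q. h \<circ> q) ` up R"
proof
  define q where "q = (\<lambda>n. inv_into (carrier R) h (p n))"
  have hq: "h (q n) = p n" and qc: "q n \<in> carrier R" for n
    using assms(3)[of n] by (auto simp: q_def f_inv_into_f inv_into_into)
  then show "p = h \<circ> q" by auto
  from assms(2) obtain n where "bound \<zero>\<^bsub>S\<^esub> n p" by blast
  then have "bound \<zero> n q"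
    using inj_hom_zero_iff[OF assms(1) qc] by (auto simp: bound_def hq)
  then show "q \<in> up R" using qc by auto
qed


section \<open>Skew polynomials over the localization\<close>

context ring
begin

lemma localization_embedding:
  "ring_hom_ring R L (frac R cr \<one>)" "inj_on (frac R cr \<one>) (carrier R)"
proof -
  show "ring_hom_ring R L (frac R cr \<one>)"
    by (intro ring_hom_ringI2 ring_axioms ring_localization ring_hom_memI)
      (simp_all add: frac_closed cr_one frac_mult frac_add localization_one)
  show "inj_on (frac R cr \<one>) (carrier R)"
    by (auto simp: inj_on_def frac_eq_iff cr_one)
qed

lemma regular_element_localization:
  assumes "d \<in> cr" shows "regular_element L (frac R cr \<one> d)"
  unfolding regular_element_def
proof (intro conjI ballI impI)
  note d = assms cr_carrier[OF assms]
  fix X assume "X \<in> carrier L"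
  then obtain v s where X: "v \<in> cr" "s \<in> carrier R" "X = frac R cr v s" by (rule localizationE)
  \<comment> \<open>As \<open>d\<close> is central, both one-sided products of \<open>X\<close> with
    the image of \<open>d\<close> equal \<open>frac R cr v (d \<otimes> s)\<close>, so one argument
    serves both.\<close>
  have zero: "X = \<zero>\<^bsub>L\<^esub>" if "frac R cr v (d \<otimes> s) = \<zero>\<^bsub>L\<^esub>"
  proof -
    have "d \<otimes> s = \<zero>"
      using that X(1,2) d by (simp add: localization_zero frac_eq_iff cr_one cr_carrier)
    then have "s = \<zero>" by (rule cr_zeroD[OF assms X(2)])
    then show ?thesis
      using X(1) by (simp add: X(3) localization_zero frac_eq_iff cr_one cr_carrier)
  qed
  show "X = \<zero>\<^bsub>L\<^esub>" if "frac R cr \<one> d \<otimes>\<^bsub>L\<^esub> X = \<zero>\<^bsub>L\<^esub>"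
    using that X(1,2) d by (intro zero) (simp add: X(3) frac_mult cr_one cr_carrier)
  show "X = \<zero>\<^bsub>L\<^esub>" if "X \<otimes>\<^bsub>L\<^esub> frac R cr \<one> d = \<zero>\<^bsub>L\<^esub>"
    using that X(1,2) d by (intro zero) (simp add: X(3) frac_mult cr_one cr_carrier flip: cr_comm)
qed

text \<open>Induction on \<open>n\<close>: if \<open>d\<close> clears the earlier coefficients and
  \<open>c\<close> the new one, then \<open>d \<otimes> c\<close> clears them all. The family
  \<open>\<phi>\<close> covers two cases: identities give ordinary common denominators, and powers
  of \<open>\<sigma>\<close> fit right multiplication by a constant skew polynomial.\<close>

lemma common_denominator:
  fixes n :: nat
  assumes hom: "\<And>i. \<phi> i \<in> ring_hom R R" and surj: "\<And>i. \<phi> i ` cr = cr"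
    and b: "\<And>i. b i \<in> carrier L"
  shows "\<exists>d\<in>cr. \<forall>i<n. b i \<otimes>\<^bsub>L\<^esub> frac R cr \<one> (\<phi> i d) \<in> frac R cr \<one> ` carrier R"
proof (induction n)
  case 0
  then show ?case using cr_one by blast
next
  case (Suc n)
  then obtain d where d: "d \<in> cr"
    "\<And>i. i < n \<Longrightarrow> b i \<otimes>\<^bsub>L\<^esub> frac R cr \<one> (\<phi> i d) \<in> frac R cr \<one> ` carrier R" by blast
  interpret e: ring_hom_ring R L "frac R cr \<one>" by (rule localization_embedding)
  from b obtain u r where u: "u \<in> cr" "r \<in> carrier R" "b n = frac R cr u r" by (rule localizationE)
  \<comment> \<open>The new denominator \<open>u\<close> need not itself be a suitable factor, since
    \<open>\<phi> n\<close> is applied first; its preimage under \<open>\<phi> n\<close> is.\<close>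
  from u(1) obtain c where c: "c \<in> cr" "\<phi> n c = u" using surj[of n] by (metis imageE)
  have crs: "x \<in> cr \<Longrightarrow> \<phi> i x \<in> cr" for i x using surj[of i] by blast
  have eq: "frac R cr \<one> (\<phi> i (d \<otimes> c)) = frac R cr \<one> (\<phi> i d) \<otimes>\<^bsub>L\<^esub> frac R cr \<one> (\<phi> i c)" for i
    using c d(1) by (simp add: ring_hom_mult[OF hom] cr_carrier crs)
  have "b i \<otimes>\<^bsub>L\<^esub> frac R cr \<one> (\<phi> i (d \<otimes> c)) \<in> frac R cr \<one> ` carrier R" if "i < Suc n" for i
  proof (cases "i = n")
    case True
    define x where "x = r \<otimes> \<phi> n d"
    have x: "x \<in> carrier R" using u(2) crs[OF d(1)] by (simp add: x_def cr_carrier)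
    have uc: "u \<in> carrier R" using u(1) by (rule cr_carrier)
    have "b n \<otimes>\<^bsub>L\<^esub> frac R cr \<one> (\<phi> n (d \<otimes> c)) = frac R cr u (r \<otimes> (\<phi> n d \<otimes> u))"
      using u c d(1) by (simp add: ring_hom_mult[OF hom] cr_carrier crs cr_one frac_mult
        del: e.hom_mult)
    \<comment> \<open>The central \<open>u\<close> moves to the front of the numerator, where it
      cancels the denominator.\<close>
    also have "r \<otimes> (\<phi> n d \<otimes> u) = u \<otimes> x"
      unfolding cr_comm[OF u(1) x] using u(2) uc crs[OF d(1)] by (simp add: x_def m_assoc cr_carrier)
    also have "frac R cr u (u \<otimes> x) = frac R cr \<one> x"
      using u(1) uc x by (simp add: frac_eq_iff cr_one)
    finally show ?thesis using True x by simp
  next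
    case False
    then obtain s where s: "s \<in> carrier R" "b i \<otimes>\<^bsub>L\<^esub> frac R cr \<one> (\<phi> i d) = frac R cr \<one> s"
      using d(2)[of i] \<open>i < Suc n\<close> by auto
    have "b i \<otimes>\<^bsub>L\<^esub> frac R cr \<one> (\<phi> i (d \<otimes> c)) = frac R cr \<one> s \<otimes>\<^bsub>L\<^esub> frac R cr \<one> (\<phi> i c)"
      unfolding eq using b c d(1) by (simp add: s(2)[symmetric] e.S.m_assoc cr_carrier crs)
    also have "\<dots> = frac R cr \<one> (s \<otimes> \<phi> i c)"
      using s c by (simp add: cr_carrier crs)
    finally show ?thesis using s(1) crs[OF c(1)] by (auto simp: cr_carrier simp del: e.hom_mult)
  qed
  then show ?case using cr_mult[OF d(1) c(1)] by blast
qed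

lemma common_denominator_up:
  assumes hom: "\<And>i. \<phi> i \<in> ring_hom R R" and surj: "\<And>i. \<phi> i ` cr = cr" and b: "b \<in> up L"
  shows "\<exists>d\<in>cr. \<forall>i. b i \<otimes>\<^bsub>L\<^esub> frac R cr \<one> (\<phi> i d) \<in> frac R cr \<one> ` carrier R"
proof -
  interpret e: ring_hom_ring R L "frac R cr \<one>" by (rule localization_embedding)
  from b obtain n where n: "bound \<zero>\<^bsub>L\<^esub> n b" by blast
  \<comment> \<open>\<open>bound\<close> forces zeros only strictly above \<open>n\<close>, so the
    index \<open>n\<close> must be cleared as well, hence \<open>Suc n\<close>.\<close>
  from common_denominator[where \<phi> = \<phi> and b = b and n = "Suc n", OF hom surj] b obtain d where d: "d \<in> cr"
    "\<And>i. i < Suc n \<Longrightarrow> b i \<otimes>\<^bsub>L\<^esub> frac R cr \<one> (\<phi> i d) \<in> frac R cr \<one> ` carrier R"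
    by (auto simp: mem_upD)
  have "b i \<otimes>\<^bsub>L\<^esub> frac R cr \<one> (\<phi> i d) \<in> frac R cr \<one> ` carrier R" if "\<not> i < Suc n" for i
  proof -
    have "b i = \<zero>\<^bsub>L\<^esub>" using n that by (auto simp: bound_def)
    then have "b i \<otimes>\<^bsub>L\<^esub> frac R cr \<one> (\<phi> i d) = frac R cr \<one> \<zero>"
      using d(1) by (simp add: cr_carrier ring_hom_closed[OF hom])
    then show ?thesis by blast
  qed
  then show ?thesis using d by blast
qed

lemma cr_localization_comm:
  assumes "d \<in> cr" "X \<in> carrier L"
  shows "frac R cr \<one> d \<otimes>\<^bsub>L\<^esub> X = X \<otimes>\<^bsub>L\<^esub> frac R cr \<one> d"
  using assms(2) by (rule localizationE)
    (simp add: assms(1) frac_mult cr_one cr_carrier cr_comm)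

text \<open>Surjectivity of \<open>\<sigma>\<close> enters here: a preimage of a central regular
  element exists and is again central regular. Iterated, this allows the powers of
  \<open>\<sigma>\<close> as the family \<open>\<phi>\<close>.\<close>

lemma ring_iso_image_cr:
  assumes "\<sigma> \<in> ring_iso R R" shows "\<sigma> ` cr = cr"
proof -
  have im: "carrier R = \<sigma> ` carrier R" using assms by (simp add: ring_iso_def bij_betw_def)
  have "x \<in> \<sigma> ` cr" if x: "x \<in> cr" for x
  proof -
    have "x \<in> \<sigma> ` carrier R" using cr_carrier[OF x] im by simp
    then show ?thesis using x ring_iso_cr[OF assms] by auto
  qed
  then show ?thesis using ring_iso_cr[OF assms] cr_carrier by blast
qed

end

theorem proposition3p4:
  fixes R (structure) and \<sigma> :: "'a \<Rightarrow> 'a"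
  assumes "ring R"
    and "\<sigma> \<in> ring_iso R R"
    and "\<exists>r\<in>carrier R. \<sigma> r \<noteq> r"
    and "\<exists>r\<in>carrier R. \<sigma> r \<noteq> \<zero>"
  shows "strongly_symmetric R \<sigma> \<longleftrightarrow>
    strongly_symmetric (localization R (central_regular R))
      (localization_map R (central_regular R) \<sigma>)"
proof -
  interpret ring R by fact
  define \<sigma>' where "\<sigma>' = localization_map R cr \<sigma>"
  let ?e = "frac R cr \<one>"
  let ?A = "skew_poly_ring R \<sigma>" and ?B = "skew_poly_ring L \<sigma>'"
  have hom: "\<sigma> \<in> ring_hom R R" using assms(2) by (simp add: ring_iso_def)
  have hom': "\<sigma>' \<in> ring_hom L L"
    using localization_map_iso[OF assms(2)] by (simp add: ring_iso_def \<sigma>'_def)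
  have comm: "?e (\<sigma> x) = \<sigma>' (?e x)" if "x \<in> carrier R" for x
    using localization_map_frac[OF assms(2) cr_one that] ring_hom_one[OF hom] by (simp add: \<sigma>'_def)
  interpret e: ring_hom_ring R L ?e by (rule localization_embedding)
  interpret E: ring_hom_ring ?A ?B "\<lambda>p. ?e \<circ> p"
    using hom hom' comm by (rule e.skew_poly_ring_hom)
  have inj: "inj_on (\<lambda>p. ?e \<circ> p) (carrier ?A)"
    unfolding carrier_skew_poly_ring by (intro inj_on_comp_up localization_embedding)
  have im: "(\<sigma> ^^ i) ` cr = cr" for i
    by (induction i) (simp_all add: ring_iso_image_cr[OF assms(2)] flip: image_image)
  have const: "?e \<circ> skew_const R d = skew_const L (?e d)" for d
    by (rule ext) (simp add: skew_const_def)
  note up_eq = carrier_skew_poly_ring zero_skew_poly_ring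
  have lmult: "skew_const L (?e d) \<otimes>\<^bsub>?B\<^esub> b = (\<lambda>n. ?e d \<otimes>\<^bsub>L\<^esub> b n)"
    if "d \<in> cr" "b \<in> up L" for b d
    using e.S.skew_const_mult[OF hom'] that by (simp add: cr_carrier)
  have rmult: "b \<otimes>\<^bsub>?B\<^esub> skew_const L (?e d) = (\<lambda>n. b n \<otimes>\<^bsub>L\<^esub> ?e ((\<sigma> ^^ n) d))"
    if "d \<in> cr" "b \<in> up L" for b d
    using e.S.mult_skew_const[OF hom'] e.funpow_intertwine[OF hom comm] that by (simp add: cr_carrier)
  have constB: "skew_const L (?e d) \<in> carrier ?B" if "d \<in> cr" for d
    using that by (simp add: e.S.skew_const_closed carrier_skew_poly_ring cr_carrier)
  have "symmetric_ring ?A \<longleftrightarrow> symmetric_ring ?B"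
  proof
    assume "symmetric_ring ?B"
    then show "symmetric_ring ?A" by (rule E.inj_hom_symmetric_ring[OF inj])
  next
    assume "symmetric_ring ?A"
    then show "symmetric_ring ?B"
    proof (rule E.symmetric_ring_clear_denominators[OF inj, where D = "skew_const R ` cr"])
      show "skew_const R ` cr \<subseteq> carrier ?A"
        by (auto simp: up_eq skew_const_closed cr_carrier)
    next
      fix f assume "f \<in> skew_const R ` cr"
      then obtain d where d: "d \<in> cr" "f = skew_const R d" by blast
      \<comment> \<open>Every power is needed: right multiplication by the constant scales degree
        \<open>n\<close> by the image of \<open>(\<sigma> ^^ n) d\<close>, which lies in
        \<open>cr\<close> again. Left multiplication uses only \<open>n = 0\<close>.\<close>
      have reg: "regular_element L (?e ((\<sigma> ^^ n) d))" for n
        using regular_element_localization im[of n] d(1) by blast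
      show "regular_element ?B (?e \<circ> f)"
        unfolding regular_element_def d(2) const
      proof (intro conjI ballI impI)
        fix b assume "b \<in> carrier ?B"
        then have b: "b \<in> up L" by (simp add: up_eq)
        then have bn: "b n \<in> carrier L" for n by (rule mem_upD)
        show "b = \<zero>\<^bsub>?B\<^esub>" if "skew_const L (?e d) \<otimes>\<^bsub>?B\<^esub> b = \<zero>\<^bsub>?B\<^esub>"
          unfolding up_eq
        proof
          fix n
          have "?e d \<otimes>\<^bsub>L\<^esub> b n = \<zero>\<^bsub>L\<^esub>"
            using fun_cong[OF that, of n] by (simp add: lmult[OF d(1) b] up_eq)
          then show "b n = \<zero>\<^bsub>L\<^esub>" using reg[of 0] bn[of n] by (simp add: regular_element_def)
        qed
        show "b = \<zero>\<^bsub>?B\<^esub>" if "b \<otimes>\<^bsub>?B\<^esub> skew_const L (?e d) = \<zero>\<^bsub>?B\<^esub>"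
          unfolding up_eq
        proof
          fix n
          have "b n \<otimes>\<^bsub>L\<^esub> ?e ((\<sigma> ^^ n) d) = \<zero>\<^bsub>L\<^esub>"
            using fun_cong[OF that, of n] by (simp add: rmult[OF d(1) b] up_eq)
          then show "b n = \<zero>\<^bsub>L\<^esub>" using reg[of n] bn[of n] by (simp add: regular_element_def)
        qed
      qed
    next
      fix b assume bB: "b \<in> carrier ?B"
      then have b: "b \<in> up L" by (simp add: up_eq)
      \<comment> \<open>Constants on the left are not twisted, so the identity family suffices;
        \<open>cr_localization_comm\<close> then moves the denominator to the left of each
        coefficient.\<close>
      obtain d where d: "d \<in> cr" "\<And>i. b i \<otimes>\<^bsub>L\<^esub> ?e d \<in> ?e ` carrier R"
        using common_denominator_up[of "\<lambda>_. id" b] b by (auto simp: id_ring_hom)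
      have "skew_const L (?e d) \<otimes>\<^bsub>?B\<^esub> b \<in> (\<lambda>p. ?e \<circ> p) ` carrier ?A"
        unfolding carrier_skew_poly_ring
      proof (rule e.up_comp_image[OF localization_embedding(2)])
        show "skew_const L (?e d) \<otimes>\<^bsub>?B\<^esub> b \<in> up L"
          using E.S.m_closed[OF constB[OF d(1)] bB] by (simp add: up_eq)
        show "(skew_const L (?e d) \<otimes>\<^bsub>?B\<^esub> b) n \<in> ?e ` carrier R" for n
          using d b by (simp add: lmult cr_localization_comm mem_upD)
      qed
      then show "\<exists>f\<in>skew_const R ` cr. (?e \<circ> f) \<otimes>\<^bsub>?B\<^esub> b \<in> (\<lambda>p. ?e \<circ> p) ` carrier ?A"
        using d(1) by (auto simp only: const bex_simps)
    next
      fix b assume bB: "b \<in> carrier ?B"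
      then have b: "b \<in> up L" by (simp add: up_eq)
      \<comment> \<open>The powers of \<open>\<sigma>\<close> match the twist in
        \<open>rmult\<close>, so a single constant \<open>d\<close> clears all degrees from the
        right.\<close>
      obtain d where d: "d \<in> cr" "\<And>i. b i \<otimes>\<^bsub>L\<^esub> ?e ((\<sigma> ^^ i) d) \<in> ?e ` carrier R"
        using common_denominator_up[of "\<lambda>i. \<sigma> ^^ i" b] funpow_ring_hom[OF hom] im b by blast
      have "b \<otimes>\<^bsub>?B\<^esub> skew_const L (?e d) \<in> (\<lambda>p. ?e \<circ> p) ` carrier ?A"
        unfolding carrier_skew_poly_ring
      proof (rule e.up_comp_image[OF localization_embedding(2)])
        show "b \<otimes>\<^bsub>?B\<^esub> skew_const L (?e d) \<in> up L"
          using E.S.m_closed[OF bB constB[OF d(1)]] by (simp add: up_eq)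
        show "(b \<otimes>\<^bsub>?B\<^esub> skew_const L (?e d)) n \<in> ?e ` carrier R" for n
          using d b by (simp add: rmult)
      qed
      then show "\<exists>f\<in>skew_const R ` cr. b \<otimes>\<^bsub>?B\<^esub> (?e \<circ> f) \<in> (\<lambda>p. ?e \<circ> p) ` carrier ?A"
        using d(1) by (auto simp only: const bex_simps)
    qed
  qed
  then show ?thesis by (simp add: strongly_symmetric_def \<sigma>'_def)
qed

end
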